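(* Let $(a(n))_{n=0}^\infty$ be a sequence of complex numbers with the property that $$\sup_{j\ge0}\left[\sum_{2^j\le n<2^{j+1}}|a(n)|^2\right]<\infty.$$ Then $a$ is a Paley multiplier.
   Context: For $f\in L^1(-\pi,\pi]$, the Fourier coefficients are $\hat f(n)=\frac{1}{2\pi}\int_{-\pi}^{\pi}f(t)e^{-int}\,dt$, $n\in\mathbb{Z}$. The space $H^1$ is the set of $f\in L^1(-\pi,\pi]$ with $\hat f(n)=0$ for all $n<0$, and $H^2$ is the set of functions in $L^2(-\pi,\pi]$ with the same property. A sequence $(a(n))_{n=0}^\infty$ is a Paley multiplier if, for every $f\in H^1$, the sequence $(a(n)\hat f(n))_{n=0}^\infty$ is the sequence of Fourier coefficients of a function in $H^2$; equivalently, $(a(n)\hat f(n))_{n=0}^\infty\in\ell^2$ for every $f\in H^1$. *)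

theory Defs
  imports "HOL-Analysis.Analysis"
begin

text \<open>
  Elements of \<open>L\<^sup>1\<close> and \<open>L\<^sup>2\<close> are represented by functions on all of \<open>\<real>\<close> whose values outside
  \<open>(-\<pi>, \<pi>]\<close> are irrelevant, without passing to classes modulo almost-everywhere equality.
\<close>

abbreviation circle_measure :: "real measure" where
  "circle_measure \<equiv> lebesgue_on {-pi<..pi}"

definition L1 :: "(real \<Rightarrow> complex) set" where
  "L1 = {f. integrable circle_measure f}"

definition L2 :: "(real \<Rightarrow> complex) set" where
  "L2 = {f. f \<in> borel_measurable circle_measure \<and>
            integrable circle_measure (\<lambda>t. (cmod (f t))\<^sup>2)}"

definition fourier_coeff :: "(real \<Rightarrow> complex) \<Rightarrow> int \<Rightarrow> complex" where
  "fourier_coeff f n =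
     1 / (2 * of_real pi) *
     (LINT t|circle_measure. f t * exp (- (\<i> * of_int n * of_real t)))"

definition H1 :: "(real \<Rightarrow> complex) set" where
  "H1 = {f \<in> L1. \<forall>n<0. fourier_coeff f n = 0}"

definition H2 :: "(real \<Rightarrow> complex) set" where
  "H2 = {f \<in> L2. \<forall>n<0. fourier_coeff f n = 0}"

definition paley_multiplier :: "(nat \<Rightarrow> complex) \<Rightarrow> bool" where
  "paley_multiplier a \<longleftrightarrow>
     (\<forall>f\<in>H1. \<exists>g\<in>H2. \<forall>n::nat. fourier_coeff g (int n) = a n * fourier_coeff f (int n))"

end

theory Submission
  imports Defs
begin

text \<open>
  The heart of the matter is Paley's inequality along a sequence \<open>\<nu>\<close> with \<open>2 * \<nu> j < \<nu> k\<close> for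
  \<open>j < k\<close>. By duality it suffices to find, for small square-summable \<open>c\<close>, a trigonometric
  polynomial bounded by 1 whose coefficients at \<open>- \<nu> k\<close> are comparable to \<open>c k\<close> and whose other
  frequencies are positive, hence invisible to \<open>H\<^sup>1\<close>. Such a polynomial comes from the iteration
  \<open>s \<mapsto> (1 - 2 \<bar>c\<bar>\<^sup>2) (s + c z\<^sup>-\<^sup>\<nu> - cnj c z\<^sup>\<nu> s\<^sup>2)\<close>, a truncation of the Schur algorithm step
  \<open>s \<mapsto> (s + c z\<^sup>-\<^sup>\<nu>) / (1 + cnj c z\<^sup>\<nu> s)\<close>. Choosing in each dyadic block the index where the
  Fourier coefficient is largest, and separating blocks of even and odd number, one obtains a
  square-summable sequence of block maxima. The Riesz-Fischer theorem supplies the function in \<open>H\<^sup>2\<close>.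
\<close>

section \<open>Characters of the circle and their orthogonality\<close>

definition circle_char :: "int \<Rightarrow> real \<Rightarrow> complex" where
  "circle_char j t = exp (\<i> * of_int j * of_real t)"

lemma circle_char_mult: "circle_char j t * circle_char k t = circle_char (j + k) t"
  by (simp add: circle_char_def exp_add [symmetric] algebra_simps)

lemma norm_circle_char [simp]: "cmod (circle_char j t) = 1"
  by (simp add: circle_char_def norm_exp_eq_Re)

lemma circle_char_0 [simp]: "circle_char 0 t = 1"
  by (simp add: circle_char_def)

lemma cnj_circle_char: "cnj (circle_char j t) = circle_char (- j) t"
  by (simp add: circle_char_def exp_cnj)

lemma circle_char_diff: "circle_char (j - k) t = circle_char j t * cnj (circle_char k t)"
  by (simp add: cnj_circle_char circle_char_mult)

lemma continuous_on_circle_char [continuous_intros]: "continuous_on A (circle_char j)"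
  unfolding circle_char_def by (intro continuous_intros)

lemma borel_measurable_circle_char [measurable]: "circle_char j \<in> borel_measurable circle_measure"
  by (intro continuous_imp_measurable_on_sets_lebesgue continuous_on_circle_char) auto

lemma finite_measure_circle: "finite_measure circle_measure"
  by (rule finite_measure_lebesgue_on) (auto simp: fmeasurable_def emeasure_lborel_Ioc)

lemma measure_circle [simp]: "measure circle_measure {-pi<..pi} = 2 * pi"
  by (simp add: measure_def emeasure_restrict_space)

lemma integrable_circle_char: "integrable circle_measure (circle_char j)"
  by (rule finite_measure.integrable_const_bound [OF finite_measure_circle, where B = 1]) auto

lemma integral_circle_char:
  "(LINT t|circle_measure. circle_char j t) = (if j = 0 then 2 * of_real pi else 0)"
proof (cases "j = 0")
  case True
  then show ?thesis by (simp add: scaleR_conv_of_real)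
next
  case False
  \<comment> \<open>An antiderivative of the character; being 2 pi periodic it agrees at both
    endpoints, so the integral vanishes.\<close>
  define F where "F t = circle_char j t / (\<i> * of_int j)" for t
  have "(circle_char j has_integral F pi - F (- pi)) {-pi..pi}"
  proof (rule fundamental_theorem_of_calculus)
    show "(F has_vector_derivative circle_char j t) (at t within {-pi..pi})" for t
      unfolding F_def circle_char_def
      by (rule has_vector_derivative_real_field) (use False in \<open>auto intro!: derivative_eq_intros\<close>)
  qed simp
  moreover have "F pi = F (- pi)"
  proof -
    have "exp (\<i> * of_int j * of_real pi) = exp (- (\<i> * of_int j * of_real pi) + (2 * of_int j * of_real pi) * \<i>)"
      by (rule arg_cong [of _ _ exp]) (simp add: algebra_simps)
    also have "\<dots> = exp (- (\<i> * of_int j * of_real pi))"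
      using exp_integer_2pi [of "of_int j"] unfolding exp_add by simp
    finally show ?thesis by (simp add: F_def circle_char_def)
  qed
  ultimately have "integral {-pi..pi} (circle_char j) = 0"
    by (simp add: integral_unique)
  \<comment> \<open>The two intervals differ in the single point -pi, a null set.\<close>
  moreover have "integral {-pi<..pi} (circle_char j) = integral {-pi..pi} (circle_char j)"
    by (rule integral_subset_negligible[where S = "{-pi<..pi}" and T = "{-pi..pi}", symmetric, THEN sym])
      (auto intro: negligible_subset[of "{-pi}"])
  ultimately show ?thesis
    using False by (simp add: lebesgue_integral_eq_integral integrable_circle_char)
qed

lemma fourier_coeff_eq:
  "fourier_coeff f n = 1 / (2 * of_real pi) * (LINT t|circle_measure. f t * circle_char (- n) t)"
  by (simp add: fourier_coeff_def circle_char_def)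

lemma integrable_mult_circle_char:
  assumes "integrable circle_measure f"
  shows "integrable circle_measure (\<lambda>t. f t * circle_char j t)"
  using assms by (rule Bochner_Integration.integrable_bound) (use assms in \<open>auto simp: norm_mult\<close>)

lemma integral_mult_circle_char:
  "(LINT t|circle_measure. f t * circle_char j t) = 2 * of_real pi * fourier_coeff f (- j)"
  by (simp add: fourier_coeff_eq)

section \<open>Trigonometric polynomials with frequencies bounded below\<close>

text \<open>Only a lower bound for the frequencies is recorded: it adds up under products, and the
  bound 1 already gives orthogonality to \<open>H1\<close>.\<close>

inductive trig_poly_ge :: "int \<Rightarrow> (real \<Rightarrow> complex) \<Rightarrow> bool" for m where
  zero: "trig_poly_ge m (\<lambda>t. 0)"
| step: "m \<le> j \<Longrightarrow> trig_poly_ge m q \<Longrightarrow> trig_poly_ge m (\<lambda>t. c * circle_char j t + q t)"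

lemma trig_poly_ge_monom: "m \<le> j \<Longrightarrow> trig_poly_ge m (\<lambda>t. c * circle_char j t)"
  using trig_poly_ge.step [OF _ trig_poly_ge.zero] by simp

lemma trig_poly_ge_mono: "trig_poly_ge m q \<Longrightarrow> m' \<le> m \<Longrightarrow> trig_poly_ge m' q"
  by (induction rule: trig_poly_ge.induct) (auto intro: trig_poly_ge.intros)

lemma trig_poly_ge_add:
  "trig_poly_ge m p \<Longrightarrow> trig_poly_ge m q \<Longrightarrow> trig_poly_ge m (\<lambda>t. p t + q t)"
  by (induction rule: trig_poly_ge.induct) (auto simp: add.assoc intro: trig_poly_ge.intros)

lemma trig_poly_ge_sum:
  "(\<And>k. k \<in> A \<Longrightarrow> trig_poly_ge m (q k)) \<Longrightarrow> trig_poly_ge m (\<lambda>t. \<Sum>k\<in>A. q k t)"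
  by (induction A rule: infinite_finite_induct) (auto intro: trig_poly_ge.zero trig_poly_ge_add)

lemma trig_poly_ge_monom_mult:
  assumes "trig_poly_ge m q"
  shows "trig_poly_ge (j + m) (\<lambda>t. c * circle_char j t * q t)"
  using assms
proof induction
  case zero
  then show ?case by (simp add: trig_poly_ge.zero)
next
  case (step k q b)
  have "(\<lambda>t. c * circle_char j t * (b * circle_char k t + q t)) =
        (\<lambda>t. (c * b) * circle_char (j + k) t + c * circle_char j t * q t)"
    by (simp add: fun_eq_iff circle_char_mult [symmetric] algebra_simps)
  then show ?case using step by (auto intro: trig_poly_ge.step)
qed

lemma trig_poly_ge_cmult: "trig_poly_ge m q \<Longrightarrow> trig_poly_ge m (\<lambda>t. c * q t)"
  using trig_poly_ge_monom_mult [of m q 0 c] by simp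

lemma trig_poly_ge_mult:
  assumes "trig_poly_ge m p" "trig_poly_ge m' q"
  shows "trig_poly_ge (m + m') (\<lambda>t. p t * q t)"
  using assms(1)
proof induction
  case zero
  then show ?case by (simp add: trig_poly_ge.zero)
next
  case (step k p b)
  have "trig_poly_ge (m + m') (\<lambda>t. b * circle_char k t * q t)"
    using trig_poly_ge_mono [OF trig_poly_ge_monom_mult [OF assms(2)]] step.hyps by simp
  then show ?case using step by (auto simp: distrib_right intro: trig_poly_ge_add)
qed

lemma trig_poly_ge_measurable: "trig_poly_ge m q \<Longrightarrow> q \<in> borel_measurable circle_measure"
  by (induction rule: trig_poly_ge.induct) auto

text \<open>A monomial of frequency \<open>j\<close> picks out the coefficient of \<open>f\<close>
  at \<open>- j\<close>, which is zero for \<open>j\<close> at least 1. This makes the remainder of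
  the Schur polynomials invisible to \<open>H1\<close>.\<close>

lemma trig_poly_ge_integral_H1:
  assumes "f \<in> H1" "trig_poly_ge 1 q"
  shows "integrable circle_measure (\<lambda>t. f t * q t)" "(LINT t|circle_measure. f t * q t) = 0"
proof -
  have f: "integrable circle_measure f" using assms by (auto simp: H1_def L1_def)
  have "integrable circle_measure (\<lambda>t. f t * q t) \<and> (LINT t|circle_measure. f t * q t) = 0"
    using assms(2)
  proof induction
    case (step j q c)
    have eq: "(\<lambda>t. f t * (c * circle_char j t + q t)) = (\<lambda>t. c * (f t * circle_char j t) + f t * q t)"
      by (simp add: fun_eq_iff algebra_simps)
    have "fourier_coeff f (- j) = 0" using assms(1) step.hyps by (auto simp: H1_def)
    then show ?case using step.IH integrable_mult_circle_char [OF f]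
      unfolding eq by (simp add: integral_mult_circle_char)
  qed auto
  then show "integrable circle_measure (\<lambda>t. f t * q t)" "(LINT t|circle_measure. f t * q t) = 0"
    by auto
qed

section \<open>Bounded polynomials from the truncated Schur algorithm\<close>

text \<open>In the cross term, \<open>cnj d * u\<close> and \<open>d * cnj u\<close> have the same
  real part, which produces the factor 1 - |u|^2. Hence there is no first-order growth in
  \<open>d\<close> where |u| = 1.\<close>

lemma norm_schur_identity:
  fixes u d :: complex
  shows "(cmod (u + d - cnj d * u\<^sup>2))\<^sup>2 =
      (cmod u)\<^sup>2 + 2 * (1 - (cmod u)\<^sup>2) * Re (cnj d * u) + (cmod (d - cnj d * u\<^sup>2))\<^sup>2"
proof -
  have "(cmod (u + z))\<^sup>2 = (cmod u)\<^sup>2 + 2 * Re (u * cnj z) + (cmod z)\<^sup>2" for z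
    unfolding cmod_power2 by (simp add: power2_eq_square algebra_simps)
  from this [of "d - cnj d * u\<^sup>2"]
  have "(cmod (u + d - cnj d * u\<^sup>2))\<^sup>2 = (cmod u)\<^sup>2 + 2 * Re (u * cnj (d - cnj d * u\<^sup>2)) + (cmod (d - cnj d * u\<^sup>2))\<^sup>2"
    by (simp only: add_diff_eq)
  also have "u * cnj (d - cnj d * u\<^sup>2) = cnj d * u - of_real ((cmod u)\<^sup>2) * (d * cnj u)"
    unfolding complex_norm_square by (simp add: power2_eq_square right_diff_distrib)
  also have "Re \<dots> = (1 - (cmod u)\<^sup>2) * Re (cnj d * u)"
    by (simp add: left_diff_distrib del: of_real_power)
  finally show ?thesis by simp
qed

text \<open>Since |c| is at most 1/2, the cross term of the identity is at most 1 - |u|^2, and the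
  last term is at most 4 |c|^2. So the squared modulus is at most 1 + 4 |c|^2, hence at most (1 + 2
  |c|^2)^2, and the damping factor compensates because (1 - 2x)(1 + 2x) is at most 1.\<close>

lemma schur_step_bound:
  fixes u c w :: complex
  assumes "cmod u \<le> 1" "cmod w = 1" "cmod c \<le> 1 / 2"
  shows "(1 - 2 * (cmod c)\<^sup>2) * cmod (u + c * cnj w - cnj c * w * u\<^sup>2) \<le> 1"
proof -
  define d where "d = c * cnj w"
  define x where "x = (cmod c)\<^sup>2"
  have d: "cmod d = cmod c" "cnj c * w = cnj d" using assms(2) by (auto simp: d_def norm_mult)
  have x: "0 \<le> x" "x \<le> 1 / 4"
    using power_mono [OF assms(3), of 2] by (auto simp: x_def power2_eq_square)
  have "(cmod (u + d - cnj d * u\<^sup>2))\<^sup>2 =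
      (cmod u)\<^sup>2 + 2 * (1 - (cmod u)\<^sup>2) * Re (cnj d * u) + (cmod (d - cnj d * u\<^sup>2))\<^sup>2"
    by (rule norm_schur_identity)
  also have "2 * (1 - (cmod u)\<^sup>2) * Re (cnj d * u) \<le> (1 - (cmod u)\<^sup>2) * 1"
  proof -
    have "Re (cnj d * u) \<le> cmod d * cmod u"
      using complex_Re_le_cmod [of "cnj d * u"] by (simp add: norm_mult)
    also have "\<dots> \<le> 1 / 2 * 1" using assms d by (intro mult_mono) auto
    finally have "(1 - (cmod u)\<^sup>2) * (2 * Re (cnj d * u)) \<le> (1 - (cmod u)\<^sup>2) * 1"
      using assms(1) by (intro mult_left_mono) (auto simp: power_le_one)
    then show ?thesis by (simp add: algebra_simps)
  qed
  also have "(cmod (d - cnj d * u\<^sup>2))\<^sup>2 \<le> (2 * cmod c)\<^sup>2"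
  proof (rule power_mono)
    have "cmod (d - cnj d * u\<^sup>2) \<le> cmod d + cmod d * (cmod u)\<^sup>2"
      using norm_triangle_ineq4 [of d "cnj d * u\<^sup>2"] by (simp add: norm_mult norm_power)
    also have "\<dots> \<le> cmod d + cmod d * 1"
      using assms(1) by (intro add_left_mono mult_left_mono) (auto simp: power_le_one)
    finally show "cmod (d - cnj d * u\<^sup>2) \<le> 2 * cmod c" using d by simp
  qed simp
  finally have "(cmod (u + d - cnj d * u\<^sup>2))\<^sup>2 \<le> 1 + 4 * x"
    by (simp add: x_def power_mult_distrib)
  also have "\<dots> \<le> (1 + 2 * x)\<^sup>2" by (simp add: power2_sum power_mult_distrib)
  finally have "cmod (u + d - cnj d * u\<^sup>2) \<le> 1 + 2 * x"
    by (rule power2_le_imp_le) (use x in simp)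
  then have "(1 - 2 * x) * cmod (u + d - cnj d * u\<^sup>2) \<le> (1 - 2 * x) * (1 + 2 * x)"
    using x by (intro mult_left_mono) auto
  also have "\<dots> \<le> 1" by (simp add: algebra_simps)
  finally show ?thesis unfolding d(2) by (simp only: d_def x_def)
qed

text \<open>The damping factors accumulate to a product, which stays bounded below when the sum of
  |c|^2 is small.\<close>

primrec schur :: "(nat \<Rightarrow> complex) \<Rightarrow> (nat \<Rightarrow> nat) \<Rightarrow> nat \<Rightarrow> real \<Rightarrow> complex" where
  "schur c \<nu> 0 t = 0"
| "schur c \<nu> (Suc N) t = of_real (1 - 2 * (cmod (c N))\<^sup>2) *
     (schur c \<nu> N t + c N * circle_char (- int (\<nu> N)) t
       - cnj (c N) * circle_char (int (\<nu> N)) t * (schur c \<nu> N t)\<^sup>2)"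

lemma norm_schur_le_1:
  assumes "\<And>k. k < N \<Longrightarrow> cmod (c k) \<le> 1 / 2"
  shows "cmod (schur c \<nu> N t) \<le> 1"
  using assms
proof (induction N)
  case (Suc N)
  have "\<bar>1 - 2 * (cmod (c N))\<^sup>2\<bar> = 1 - 2 * (cmod (c N))\<^sup>2"
    using power_mono [OF Suc.prems [of N], of 2] by (simp add: power2_eq_square)
  then show ?case
    using schur_step_bound [of "schur c \<nu> N t" "circle_char (int (\<nu> N)) t" "c N"] Suc
    by (simp add: norm_mult cnj_circle_char del: of_real_diff)
qed auto

text \<open>
  The lacunarity enters through the quadratic term: its frequencies are at least
  \<open>\<nu> N - 2 * max {\<nu> k | k < N}\<close>, which is positive.
\<close>
lemma schur_expansion:
  assumes "\<And>j k. j < k \<Longrightarrow> 2 * \<nu> j < \<nu> k"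
  shows "\<exists>q. trig_poly_ge 1 q \<and> (\<forall>t. schur c \<nu> N t =
    (\<Sum>k<N. c k * of_real (\<Prod>j=k..<N. 1 - 2 * (cmod (c j))\<^sup>2) * circle_char (- int (\<nu> k)) t) + q t)"
proof (induction N)
  case 0
  then show ?case by (auto intro: trig_poly_ge.zero)
next
  case (Suc N)
  define \<rho> where "\<rho> = 1 - 2 * (cmod (c N))\<^sup>2"
  define d where "d N k = c k * of_real (\<Prod>j=k..<N. 1 - 2 * (cmod (c j))\<^sup>2)" for N k
  obtain q where q: "trig_poly_ge 1 q"
    "\<And>t. schur c \<nu> N t = (\<Sum>k<N. d N k * circle_char (- int (\<nu> k)) t) + q t"
    using Suc by (auto simp: d_def)
  \<comment> \<open>From 2 \<open>\<nu> k\<close> < \<open>\<nu> N\<close>, every earlier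
    \<open>\<nu> k\<close> is at most \<open>- m\<close>, so \<open>m\<close> bounds the frequencies
    of the previous polynomial from below. Rounding down ensures that \<open>\<nu> N\<close> + 2
    \<open>m\<close> is at least 1.\<close>
  define m where "m = - ((int (\<nu> N) - 1) div 2)"
  have "trig_poly_ge m (\<lambda>t. (\<Sum>k<N. d N k * circle_char (- int (\<nu> k)) t) + q t)"
  proof (intro trig_poly_ge_add trig_poly_ge_sum trig_poly_ge_monom)
    show "m \<le> - int (\<nu> k)" if "k \<in> {..<N}" for k
      using assms [of k N] that unfolding m_def by simp
    show "trig_poly_ge m q" using q(1) by (rule trig_poly_ge_mono) (simp add: m_def)
  qed
  then have "trig_poly_ge m (schur c \<nu> N)" unfolding q(2) [symmetric] .
  then have "trig_poly_ge (int (\<nu> N) + (m + m))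
      (\<lambda>t. - (of_real \<rho> * cnj (c N)) * circle_char (int (\<nu> N)) t * (schur c \<nu> N t * schur c \<nu> N t))"
    by (intro trig_poly_ge_monom_mult trig_poly_ge_mult)
  \<comment> \<open>The new remainder: the damped old one together with the quadratic term.\<close>
  then have "trig_poly_ge 1 (\<lambda>t. of_real \<rho> * q t +
      - (of_real \<rho> * cnj (c N)) * circle_char (int (\<nu> N)) t * (schur c \<nu> N t * schur c \<nu> N t))"
    by (intro trig_poly_ge_add trig_poly_ge_cmult q(1))
      (erule trig_poly_ge_mono, simp add: m_def)
  moreover have "d (Suc N) k = of_real \<rho> * d N k" if "k < N" for k
    using that by (simp add: d_def \<rho>_def del: of_real_diff)
  then have d_Suc: "(\<Sum>k<Suc N. d (Suc N) k * circle_char (- int (\<nu> k)) t) =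
      of_real \<rho> * (\<Sum>k<N. d N k * circle_char (- int (\<nu> k)) t) + of_real \<rho> * c N * circle_char (- int (\<nu> N)) t" for t
    by (simp add: sum_distrib_left mult.assoc d_def [of "Suc N" N] \<rho>_def [symmetric] del: of_real_diff)
  have "schur c \<nu> (Suc N) t = (\<Sum>k<Suc N. d (Suc N) k * circle_char (- int (\<nu> k)) t) +
      (of_real \<rho> * q t + - (of_real \<rho> * cnj (c N)) * circle_char (int (\<nu> N)) t *
        (schur c \<nu> N t * schur c \<nu> N t))" for t
  proof -
    have A: "(\<Sum>k<N. d N k * circle_char (- int (\<nu> k)) t) = schur c \<nu> N t - q t"
      by (simp add: q(2))
    then show ?thesis
      unfolding d_Suc schur.simps \<rho>_def [symmetric] A by (simp add: algebra_simps power2_eq_square)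
  qed
  ultimately show ?case unfolding d_def by blast
qed

section \<open>Paley's inequality along lacunary sequences\<close>

text \<open>Pair \<open>f\<close> with the Schur polynomial. Its remainder integrates to zero
  against \<open>f\<close>, its monomials at \<open>- \<nu> k\<close> yield the coefficients of
  \<open>f\<close> at \<open>\<nu> k\<close>, and the polynomial is bounded by 1, so the pairing is
  at most the integral of |f|.\<close>

lemma lacunary_duality:
  fixes \<nu> :: "nat \<Rightarrow> nat" and c :: "nat \<Rightarrow> complex"
  assumes f: "f \<in> H1" and lac: "\<And>j k. j < k \<Longrightarrow> 2 * \<nu> j < \<nu> k"
    and c: "\<And>k. k < N \<Longrightarrow> cmod (c k) \<le> 1 / 2"
  shows "2 * pi * cmod (\<Sum>k<N. c k * of_real (\<Prod>j=k..<N. 1 - 2 * (cmod (c j))\<^sup>2) * fourier_coeff f (int (\<nu> k)))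
    \<le> (LINT t|circle_measure. cmod (f t))"
proof -
  define d where "d k = c k * of_real (\<Prod>j=k..<N. 1 - 2 * (cmod (c j))\<^sup>2)" for k
  have fi: "integrable circle_measure f" using f by (auto simp: H1_def L1_def)
  then have [measurable]: "f \<in> borel_measurable circle_measure" by auto
  obtain q where q: "trig_poly_ge 1 q"
    "\<And>t. schur c \<nu> N t = (\<Sum>k<N. d k * circle_char (- int (\<nu> k)) t) + q t"
    using schur_expansion [of \<nu>, OF lac] unfolding d_def by blast
  have [measurable]: "q \<in> borel_measurable circle_measure" using q(1) by (rule trig_poly_ge_measurable)
  have [measurable]: "schur c \<nu> N \<in> borel_measurable circle_measure"
  proof -
    have "schur c \<nu> N = (\<lambda>t. (\<Sum>k<N. d k * circle_char (- int (\<nu> k)) t) + q t)"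
      by (rule ext) (rule q(2))
    then show ?thesis by simp
  qed
  have "(LINT t|circle_measure. f t * schur c \<nu> N t) =
    (LINT t|circle_measure. (\<Sum>k<N. d k * (f t * circle_char (- int (\<nu> k)) t)) + f t * q t)"
    by (simp add: q(2) distrib_left sum_distrib_left mult_ac)
  also have "\<dots> = (\<Sum>k<N. d k * (2 * of_real pi * fourier_coeff f (int (\<nu> k))))"
    using trig_poly_ge_integral_H1 [OF f q(1)] integrable_mult_circle_char [OF fi]
    by (simp add: integral_mult_circle_char)
  also have "\<dots> = 2 * of_real pi * (\<Sum>k<N. d k * fourier_coeff f (int (\<nu> k)))"
    by (simp add: sum_distrib_left algebra_simps)
  finally have "2 * pi * cmod (\<Sum>k<N. d k * fourier_coeff f (int (\<nu> k))) =
      cmod (LINT t|circle_measure. f t * schur c \<nu> N t)"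
    by (simp add: norm_mult)
  also have "\<dots> \<le> (LINT t|circle_measure. cmod (f t * schur c \<nu> N t))" by simp
  also have "\<dots> \<le> (LINT t|circle_measure. cmod (f t))"
  proof (rule integral_mono)
    show le: "cmod (f t * schur c \<nu> N t) \<le> cmod (f t)" for t
    proof -
      have "cmod (schur c \<nu> N t) \<le> 1" by (rule norm_schur_le_1) (rule c)
      then show ?thesis unfolding norm_mult by (rule mult_left_le) simp
    qed
    show "integrable circle_measure (\<lambda>t. cmod (f t * schur c \<nu> N t))"
      using fi by (rule Bochner_Integration.integrable_bound) (use le in auto)
  qed (use fi in auto)
  finally show ?thesis by (simp add: d_def)
qed

text \<open>Duality is applied with \<open>c\<close> proportional to the conjugate coefficients,
  scaled so that the damping products stay above 1/2. The resulting bound depends neither on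
  \<open>N\<close> nor on \<open>\<nu>\<close>.\<close>

lemma lacunary_paley:
  fixes \<nu> :: "nat \<Rightarrow> nat"
  assumes f: "f \<in> H1" and lac: "\<And>j k. j < k \<Longrightarrow> 2 * \<nu> j < \<nu> k"
  shows "(\<Sum>k<N. (cmod (fourier_coeff f (int (\<nu> k))))\<^sup>2) \<le> (LINT t|circle_measure. cmod (f t))\<^sup>2"
proof -
  define b where "b k = fourier_coeff f (int (\<nu> k))" for k
  define S where "S = (\<Sum>k<N. (cmod (b k))\<^sup>2)"
  define I where "I = (LINT t|circle_measure. cmod (f t))"
  have I: "0 \<le> I" by (simp add: I_def)
  have S0: "0 \<le> S" by (auto simp: S_def sum_nonneg)
  have "sqrt S \<le> I"
  proof (cases "S = 0")
    case False
    \<comment> \<open>This scaling makes the sum of |c|^2 equal to 1/4, which gives both |c| at most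
      1/2 and a sum of 2 |c|^2 equal to 1/2.\<close>
    define r where "r = 2 * sqrt S"
    define c where "c k = cnj (b k) / of_real r" for k
    define p where "p k = (\<Prod>j=k..<N. 1 - 2 * (cmod (c j))\<^sup>2)" for k
    have r: "r > 0" using False S0 by (simp add: r_def)
    have cS: "(\<Sum>k<N. (cmod (c k))\<^sup>2) = 1 / 4"
    proof -
      have "(cmod (c k))\<^sup>2 = (cmod (b k))\<^sup>2 / (4 * S)" for k
        using S0 by (simp add: c_def norm_divide power_divide r_def power_mult_distrib)
      then have "(\<Sum>k<N. (cmod (c k))\<^sup>2) = S / (4 * S)"
        by (simp only: sum_divide_distrib [symmetric] S_def [symmetric])
      then show ?thesis using False by simp
    qed
    have c2: "(cmod (c k))\<^sup>2 \<le> 1 / 4" if "k < N" for k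
      using member_le_sum [of k "{..<N}" "\<lambda>k. (cmod (c k))\<^sup>2"] that unfolding cS by simp
    have c: "cmod (c k) \<le> 1 / 2" if "k < N" for k
      by (rule power2_le_imp_le) (use c2 [OF that] in \<open>simp_all add: power_divide\<close>)
    have p: "p k \<ge> 1 / 2" if "k < N" for k
    proof -
      have "(\<Sum>j=k..<N. 2 * (cmod (c j))\<^sup>2) \<le> (\<Sum>j<N. 2 * (cmod (c j))\<^sup>2)"
        by (rule sum_mono2) auto
      also have "\<dots> = 1 / 2" by (simp add: sum_distrib_left [symmetric] cS)
      finally have "1 / 2 \<le> 1 - (\<Sum>j=k..<N. 2 * (cmod (c j))\<^sup>2)" by simp
      \<comment> \<open>A product of factors 1 - x with x in [0, 1] is at least 1 minus the sum of
        the x.\<close>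
      also have "\<dots> \<le> p k" unfolding p_def
      proof (rule Weierstrass_prod_ineq)
        show "2 * (cmod (c j))\<^sup>2 \<in> {0..1}" if "j \<in> {k..<N}" for j
          using c2 [of j] that by simp
      qed
      finally show ?thesis .
    qed
    \<comment> \<open>The phase of \<open>c\<close> makes each summand real, and nonnegative for
      \<open>k < N\<close>, so nothing cancels in the sum.\<close>
    have summand: "c k * of_real (p k) * b k = of_real (p k * (cmod (b k))\<^sup>2 / r)" for k
    proof -
      have "c k * of_real (p k) * b k = of_real (p k) * (b k * cnj (b k)) / of_real r"
        by (simp add: c_def)
      then show ?thesis by (simp only: complex_norm_square [symmetric] of_real_mult of_real_divide)
    qed
    \<comment> \<open>\<open>S / (2 * r)\<close> is what remains of the sum when each
      \<open>p k\<close> is replaced by its lower bound 1/2.\<close>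
    have "sqrt S * (2 * r) = S * 4" using S0 by (simp add: r_def)
    then have "sqrt S / 4 = S / (2 * r)" using r by (simp add: field_simps)
    also have "\<dots> = (\<Sum>k<N. 1 / 2 * (cmod (b k))\<^sup>2 / r)"
      by (simp add: S_def sum_divide_distrib)
    finally have "2 * pi * (sqrt S / 4) = 2 * pi * (\<Sum>k<N. 1 / 2 * (cmod (b k))\<^sup>2 / r)" by simp
    also have "\<dots> \<le> 2 * pi * (\<Sum>k<N. p k * (cmod (b k))\<^sup>2 / r)"
      using r p by (intro mult_left_mono sum_mono divide_right_mono mult_right_mono) auto
    also have "\<dots> \<le> 2 * pi * cmod (\<Sum>k<N. c k * of_real (p k) * b k)"
      unfolding summand of_real_sum [symmetric] norm_of_real by (intro mult_left_mono) auto
    also have "\<dots> \<le> I"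
      using lacunary_duality [OF f lac c] unfolding b_def p_def I_def by simp
    finally have "pi * sqrt S / 2 \<le> I" by simp
    moreover have "2 * sqrt S \<le> pi * sqrt S" using S0 pi_ge_two by (intro mult_right_mono) auto
    ultimately show ?thesis by simp
  qed (use I in simp)
  then have "(sqrt S)\<^sup>2 \<le> I\<^sup>2" using S0 by (intro power_mono) auto
  then show ?thesis using S0 by (simp add: S_def I_def b_def)
qed


section \<open>Mean square estimates, Parseval and Riesz-Fischer\<close>

lemma integral_norm_le_L2:
  fixes u :: "real \<Rightarrow> complex"
  assumes [measurable]: "u \<in> borel_measurable circle_measure"
    and u2: "integrable circle_measure (\<lambda>t. (cmod (u t))\<^sup>2)"
  shows "integrable circle_measure u"
    and "(LINT t|circle_measure. cmod (u t))\<^sup>2 \<le> 2 * pi * (LINT t|circle_measure. (cmod (u t))\<^sup>2)"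
proof -
  interpret finite_measure circle_measure by (rule finite_measure_circle)
  have "integrable circle_measure (\<lambda>t. cmod (u t))"
    by (rule square_integrable_imp_integrable) (use u2 in auto)
  then show u1: "integrable circle_measure u" by (subst (asm) integrable_norm_iff) auto
  define I where "I = (LINT t|circle_measure. cmod (u t))"
  \<comment> \<open>\<open>m\<close> is the mean of |u|; nonnegativity of the variance gives the
    Cauchy-Schwarz inequality against the constant 1.\<close>
  define m where "m = I / (2 * pi)"
  have "0 \<le> (LINT t|circle_measure. (cmod (u t) - m)\<^sup>2)" by simp
  also have "\<dots> = (LINT t|circle_measure. (cmod (u t))\<^sup>2 - 2 * m * cmod (u t) + m\<^sup>2)"
    by (simp add: power2_diff algebra_simps)
  also have "\<dots> = (LINT t|circle_measure. (cmod (u t))\<^sup>2) - 2 * m * I + 2 * pi * m\<^sup>2"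
    using u1 u2 by (simp add: I_def)
  also have "\<dots> = (LINT t|circle_measure. (cmod (u t))\<^sup>2) - I\<^sup>2 / (2 * pi)"
    by (simp add: m_def field_simps power2_eq_square)
  finally show "(LINT t|circle_measure. cmod (u t))\<^sup>2 \<le> 2 * pi * (LINT t|circle_measure. (cmod (u t))\<^sup>2)"
    by (simp add: I_def field_simps)
qed

text \<open>Continuity of each coefficient in mean square, for passing to the limit in
  \<open>riesz_fischer\<close>. The factor 1 / (2 pi) from Cauchy-Schwarz is estimated by 1.\<close>

lemma fourier_coeff_le_L2:
  assumes "u \<in> borel_measurable circle_measure"
    and "integrable circle_measure (\<lambda>t. (cmod (u t))\<^sup>2)"
  shows "(cmod (fourier_coeff u n))\<^sup>2 \<le> (LINT t|circle_measure. (cmod (u t))\<^sup>2)"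
proof -
  define J where "J = (LINT t|circle_measure. (cmod (u t))\<^sup>2)"
  have "cmod (LINT t|circle_measure. u t * circle_char (- n) t) \<le> (LINT t|circle_measure. cmod (u t * circle_char (- n) t))"
    by simp
  then have "cmod (fourier_coeff u n) \<le> (LINT t|circle_measure. cmod (u t)) / (2 * pi)"
    by (simp add: fourier_coeff_eq norm_mult norm_divide divide_right_mono)
  then have "(cmod (fourier_coeff u n))\<^sup>2 \<le> ((LINT t|circle_measure. cmod (u t)) / (2 * pi))\<^sup>2"
    by (intro power_mono) auto
  also have "\<dots> \<le> 2 * pi * J / (2 * pi)\<^sup>2"
    unfolding power_divide J_def by (intro divide_right_mono integral_norm_le_L2 assms) auto
  also have "\<dots> = J / (2 * pi)" by (simp add: power2_eq_square)
  also have "\<dots> \<le> J / 1"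
    using pi_ge_two by (intro divide_left_mono) (auto simp: J_def)
  finally show ?thesis by (simp add: J_def)
qed

lemma fourier_coeff_add:
  assumes "integrable circle_measure f" "integrable circle_measure g"
  shows "fourier_coeff (\<lambda>t. f t + g t) n = fourier_coeff f n + fourier_coeff g n"
  using assms by (simp add: fourier_coeff_eq distrib_right integrable_mult_circle_char distrib_left)

lemma integrable_trig_sum: "integrable circle_measure (\<lambda>t. \<Sum>n\<in>A. b n * circle_char (k n) t)"
  by (intro Bochner_Integration.integrable_sum integrable_mult_right integrable_circle_char)

lemma fourier_coeff_trig_sum:
  assumes "finite A"
  shows "fourier_coeff (\<lambda>t. \<Sum>n\<in>A. b n * circle_char (int n) t) m =
    (if 0 \<le> m \<and> nat m \<in> A then b (nat m) else 0)"
proof -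
  have "(LINT t|circle_measure. (\<Sum>n\<in>A. b n * circle_char (int n) t) * circle_char (- m) t) =
        (LINT t|circle_measure. (\<Sum>n\<in>A. b n * circle_char (int n - m) t))"
    by (simp add: sum_distrib_right mult.assoc circle_char_mult)
  also have "\<dots> = (\<Sum>n\<in>A. b n * (if int n = m then 2 * of_real pi else 0))"
    by (subst Bochner_Integration.integral_sum)
      (auto simp: integrable_circle_char integral_circle_char intro!: sum.cong)
  \<comment> \<open>The sum now collapses to one index. The inner conditional excludes negative
    \<open>m\<close>, for which \<open>nat m\<close> would be 0.\<close>
  also have "\<dots> = (\<Sum>n\<in>A. if n = nat m then if 0 \<le> m then 2 * of_real pi * b n else 0 else 0)"
    by (intro sum.cong) auto
  finally show ?thesis using assms by (simp add: fourier_coeff_eq)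
qed

text \<open>Over the complex numbers the squared modulus is a double sum of characters, of which
  orthogonality keeps the diagonal; the result is then transferred back to the reals.\<close>

lemma parseval_trig_sum:
  assumes "finite A"
  shows "integrable circle_measure (\<lambda>t. (cmod (\<Sum>n\<in>A. b n * circle_char (int n) t))\<^sup>2)"
    and "(LINT t|circle_measure. (cmod (\<Sum>n\<in>A. b n * circle_char (int n) t))\<^sup>2) = 2 * pi * (\<Sum>n\<in>A. (cmod (b n))\<^sup>2)"
proof -
  have eq: "of_real ((cmod (\<Sum>n\<in>A. b n * circle_char (int n) t))\<^sup>2) =
      (\<Sum>n\<in>A. \<Sum>m\<in>A. b n * cnj (b m) * circle_char (int n - int m) t)" for t
    unfolding complex_norm_square cnj_sum sum_product
    by (intro sum.cong refl) (simp add: circle_char_diff)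
  have int: "integrable circle_measure (\<lambda>t. \<Sum>n\<in>A. \<Sum>m\<in>A. b n * cnj (b m) * circle_char (int n - int m) t)"
    by (intro Bochner_Integration.integrable_sum integrable_mult_right integrable_circle_char)
  then have "integrable circle_measure (\<lambda>t. complex_of_real ((cmod (\<Sum>n\<in>A. b n * circle_char (int n) t))\<^sup>2))"
    unfolding eq .
  then show "integrable circle_measure (\<lambda>t. (cmod (\<Sum>n\<in>A. b n * circle_char (int n) t))\<^sup>2)"
    by (simp only: complex_of_real_integrable_eq)
  have "complex_of_real (LINT t|circle_measure. (cmod (\<Sum>n\<in>A. b n * circle_char (int n) t))\<^sup>2) =
      (LINT t|circle_measure. (\<Sum>n\<in>A. \<Sum>m\<in>A. b n * cnj (b m) * circle_char (int n - int m) t))"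
    unfolding eq [symmetric] by (rule integral_complex_of_real [symmetric])
  also have "\<dots> = (\<Sum>n\<in>A. \<Sum>m\<in>A. b n * cnj (b m) * (if n = m then 2 * of_real pi else 0))"
    by (simp add: integrable_circle_char integral_circle_char)
  also have "\<dots> = (\<Sum>n\<in>A. 2 * of_real pi * of_real ((cmod (b n))\<^sup>2))"
    using assms by (intro sum.cong refl) (simp add: if_distrib complex_norm_square del: of_real_power cong: if_cong)
  also have "\<dots> = of_real (2 * pi * (\<Sum>n\<in>A. (cmod (b n))\<^sup>2))"
    by (simp add: sum_distrib_left)
  finally show "(LINT t|circle_measure. (cmod (\<Sum>n\<in>A. b n * circle_char (int n) t))\<^sup>2) = 2 * pi * (\<Sum>n\<in>A. (cmod (b n))\<^sup>2)"
    by (simp only: of_real_eq_iff)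
qed

text \<open>By Parseval the partial sums are Cauchy in mean square. A subsequence converges almost
  everywhere, and Fatou's lemma shows that its pointwise limit is also the mean square
  limit.\<close>

lemma riesz_fischer:
  assumes "summable (\<lambda>n. (cmod (b n))\<^sup>2)"
  shows "\<exists>g\<in>L2. \<forall>m. fourier_coeff g m = (if 0 \<le> m then b (nat m) else 0)"
proof -
  define S where "S N t = (\<Sum>n<N. b n * circle_char (int n) t)" for N t
  have Si: "integrable circle_measure (S N)" for N
    unfolding S_def by (rule integrable_trig_sum)
  then have [measurable]: "S N \<in> borel_measurable circle_measure" for N by auto
  have diff: "S j t - S i t = (\<Sum>n\<in>{i..<j}. b n * circle_char (int n) t)" if "i \<le> j" for i j t
    unfolding S_def lessThan_atLeast0 using that by (intro sum_diff_nat_ivl) auto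
  have S2i: "integrable circle_measure (\<lambda>t. (cmod (S j t - S i t))\<^sup>2)" for i j
  proof (cases "i \<le> j")
    case True
    then show ?thesis by (simp add: diff parseval_trig_sum)
  next
    case False
    then show ?thesis using diff [of j i] by (subst norm_minus_commute) (simp add: parseval_trig_sum)
  qed
  have small: "\<exists>N. \<forall>i\<ge>N. \<forall>j\<ge>N. (LINT t|circle_measure. (cmod (S i t - S j t))\<^sup>2) < e" if e: "e > 0" for e
  proof -
    obtain N where N: "\<And>m n. m \<ge> N \<Longrightarrow> norm (\<Sum>k\<in>{m..<n}. (cmod (b k))\<^sup>2) < e / (2 * pi)"
      using summable_Cauchy [THEN iffD1, OF assms, THEN spec, of "e / (2 * pi)"] e by (auto simp del: real_norm_def)
    have *: "(LINT t|circle_measure. (cmod (S j t - S i t))\<^sup>2) < e" if "i \<ge> N" "i \<le> j" for i j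
      using N [OF that(1), of j] that by (simp add: diff parseval_trig_sum sum_nonneg field_simps)
    show ?thesis
    proof (intro exI [of _ N] allI impI)
      fix i j assume "i \<ge> N" "j \<ge> N"
      then show "(LINT t|circle_measure. (cmod (S i t - S j t))\<^sup>2) < e"
        using * [of i j] * [of j i] by (cases "i \<le> j") (auto simp: norm_minus_commute)
    qed
  qed
  obtain r where r: "strict_mono r" "AE t in circle_measure. Cauchy (\<lambda>i. S (r i) t)"
  proof (rule cauchy_L1_AE_cauchy_subseq [of circle_measure S])
    fix e :: real assume e: "e > 0"
    \<comment> \<open>The threshold that Cauchy-Schwarz turns into an L1 distance below
      \<open>e\<close>.\<close>
    obtain N where N: "\<And>i j. i \<ge> N \<Longrightarrow> j \<ge> N \<Longrightarrow> (LINT t|circle_measure. (cmod (S i t - S j t))\<^sup>2) < e\<^sup>2 / (2 * pi)"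
      using small [of "e\<^sup>2 / (2 * pi)"] e by auto
    have "(LINT t|circle_measure. cmod (S i t - S j t)) < e" if "i \<ge> N" "j \<ge> N" for i j
    proof (rule power2_less_imp_less)
      have "(LINT t|circle_measure. cmod (S i t - S j t))\<^sup>2 \<le> 2 * pi * (LINT t|circle_measure. (cmod (S i t - S j t))\<^sup>2)"
        by (intro integral_norm_le_L2 S2i) auto
      also have "\<dots> < e\<^sup>2" using N [OF that] by (simp add: field_simps)
      finally show "(LINT t|circle_measure. cmod (S i t - S j t))\<^sup>2 < e\<^sup>2" .
    qed (use e in auto)
    then show "\<exists>N. \<forall>i\<ge>N. \<forall>j\<ge>N. (LINT t|circle_measure. cmod (S i t - S j t)) < e" by blast
  qed (use Si in auto)
  \<comment> \<open>Where the subsequence diverges \<open>lim\<close> has an unspecified value, but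
    this happens only on a null set.\<close>
  define g where "g t = lim (\<lambda>i. S (r i) t)" for t
  have [measurable]: "g \<in> borel_measurable circle_measure"
    unfolding g_def by measurable
  have lim: "AE t in circle_measure. (\<lambda>i. S (r i) t) \<longlonglongrightarrow> g t"
    using r(2) by eventually_elim (simp add: g_def Cauchy_convergent_iff convergent_LIMSEQ_iff)
  have approx: "\<exists>N. \<forall>K\<ge>N. integrable circle_measure (\<lambda>t. (cmod (g t - S K t))\<^sup>2) \<and>
      (LINT t|circle_measure. (cmod (g t - S K t))\<^sup>2) \<le> e" if e: "e > 0" for e
  proof -
    obtain N where N: "\<And>i j. i \<ge> N \<Longrightarrow> j \<ge> N \<Longrightarrow> (LINT t|circle_measure. (cmod (S i t - S j t))\<^sup>2) < e"
      using small [OF e] by blast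
    show ?thesis
    proof (intro exI [of _ N] allI impI)
      fix K assume K: "K \<ge> N"
      \<comment> \<open>Fatou's lemma is applied along the subsequence with \<open>K\<close> fixed;
        almost everywhere the liminf is a genuine limit.\<close>
      have "(\<integral>\<^sup>+t. ennreal ((cmod (g t - S K t))\<^sup>2) \<partial>circle_measure) =
          (\<integral>\<^sup>+t. liminf (\<lambda>i. ennreal ((cmod (S (r i) t - S K t))\<^sup>2)) \<partial>circle_measure)"
      proof (rule nn_integral_cong_AE)
        show "AE t in circle_measure. ennreal ((cmod (g t - S K t))\<^sup>2) = liminf (\<lambda>i. ennreal ((cmod (S (r i) t - S K t))\<^sup>2))"
          using lim
        proof eventually_elim
          case (elim t)
          then have "(\<lambda>i. ennreal ((cmod (S (r i) t - S K t))\<^sup>2)) \<longlonglongrightarrow> ennreal ((cmod (g t - S K t))\<^sup>2)"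
            by (intro tendsto_intros)
          then show ?case by (rule lim_imp_Liminf [OF trivial_limit_sequentially, symmetric])
        qed
      qed
      also have "\<dots> \<le> liminf (\<lambda>i. \<integral>\<^sup>+t. ennreal ((cmod (S (r i) t - S K t))\<^sup>2) \<partial>circle_measure)"
        by (rule nn_integral_liminf) auto
      also have "\<dots> \<le> liminf (\<lambda>i. ennreal e)"
      proof (rule Liminf_mono, rule eventually_sequentiallyI [of N])
        fix i assume "N \<le> i"
        then have "N \<le> r i" using seq_suble [OF r(1), of i] by simp
        then show "(\<integral>\<^sup>+t. ennreal ((cmod (S (r i) t - S K t))\<^sup>2) \<partial>circle_measure) \<le> ennreal e"
          using N [of "r i" K] K by (subst nn_integral_eq_integral) (simp_all add: S2i ennreal_leI less_imp_le)
      qed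
      finally have le: "(\<integral>\<^sup>+t. ennreal ((cmod (g t - S K t))\<^sup>2) \<partial>circle_measure) \<le> ennreal e"
        by (simp add: Liminf_const)
      have int: "integrable circle_measure (\<lambda>t. (cmod (g t - S K t))\<^sup>2)"
        by (rule integrableI_nonneg) (use le in \<open>auto simp: le_less_trans\<close>)
      moreover have "(LINT t|circle_measure. (cmod (g t - S K t))\<^sup>2) \<le> e"
        using le e by (simp add: nn_integral_eq_integral [OF int])
      ultimately show "integrable circle_measure (\<lambda>t. (cmod (g t - S K t))\<^sup>2) \<and>
          (LINT t|circle_measure. (cmod (g t - S K t))\<^sup>2) \<le> e" ..
    qed
  qed
  have "g \<in> L2"
  proof -
    obtain N where N: "integrable circle_measure (\<lambda>t. (cmod (g t - S N t))\<^sup>2)"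
      using approx [of 1] by auto
    \<comment> \<open>\<open>S 0\<close> is the empty sum, so \<open>S2i\<close> covers
      \<open>S N\<close> itself.\<close>
    have "integrable circle_measure (\<lambda>t. (cmod (S N t))\<^sup>2)"
      using S2i [of N 0] by (simp add: S_def)
    with N have "integrable circle_measure (\<lambda>t. 2 * (cmod (g t - S N t))\<^sup>2 + 2 * (cmod (S N t))\<^sup>2)"
      by simp
    then have "integrable circle_measure (\<lambda>t. (cmod (g t))\<^sup>2)"
    proof (rule Bochner_Integration.integrable_bound)
      have "(cmod (g t))\<^sup>2 \<le> 2 * (cmod (g t - S N t))\<^sup>2 + 2 * (cmod (S N t))\<^sup>2" for t
      proof -
        have "(cmod (g t))\<^sup>2 \<le> (cmod (g t - S N t) + cmod (S N t))\<^sup>2"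
          using norm_triangle_ineq [of "g t - S N t" "S N t"] by (intro power_mono) auto
        then show ?thesis using sum_squares_bound [of "cmod (g t - S N t)" "cmod (S N t)"]
          by (simp add: power2_sum)
      qed
      then show "AE t in circle_measure. norm ((cmod (g t))\<^sup>2) \<le> norm (2 * (cmod (g t - S N t))\<^sup>2 + 2 * (cmod (S N t))\<^sup>2)"
        by simp
    qed auto
    then show ?thesis by (simp add: L2_def)
  qed
  moreover have "fourier_coeff g m = (if 0 \<le> m then b (nat m) else 0)" for m
  proof -
    \<comment> \<open>The summand 0 matches the form of \<open>field_le_epsilon\<close>.\<close>
    have "(cmod (fourier_coeff g m - (if 0 \<le> m then b (nat m) else 0)))\<^sup>2 \<le> 0 + e" if e: "e > 0" for e
    proof -
      obtain N where N: "\<And>K. K \<ge> N \<Longrightarrow> integrable circle_measure (\<lambda>t. (cmod (g t - S K t))\<^sup>2) \<and>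
          (LINT t|circle_measure. (cmod (g t - S K t))\<^sup>2) \<le> e"
        using approx [OF e] by blast
      \<comment> \<open>Beyond \<open>nat m\<close> the coefficient of the partial sum at
        \<open>m\<close> has reached its final value.\<close>
      define K where "K = max N (Suc (nat m))"
      have K: "K > nat m" "integrable circle_measure (\<lambda>t. (cmod (g t - S K t))\<^sup>2)"
          "(LINT t|circle_measure. (cmod (g t - S K t))\<^sup>2) \<le> e"
        using N [of K] by (auto simp: K_def)
      have "fourier_coeff g m = fourier_coeff (\<lambda>t. (g t - S K t) + S K t) m" by simp
      also have "\<dots> = fourier_coeff (\<lambda>t. g t - S K t) m + fourier_coeff (S K) m"
        using K by (intro fourier_coeff_add Si integral_norm_le_L2) auto
      also have "fourier_coeff (S K) m = (if 0 \<le> m then b (nat m) else 0)"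
        using K(1) fourier_coeff_trig_sum [of "{..<K}" b m] by (simp add: S_def [abs_def])
      finally have "fourier_coeff g m - (if 0 \<le> m then b (nat m) else 0) = fourier_coeff (\<lambda>t. g t - S K t) m"
        by simp
      then show ?thesis
        using fourier_coeff_le_L2 [of "\<lambda>t. g t - S K t" m] K by auto
    qed
    then have "(cmod (fourier_coeff g m - (if 0 \<le> m then b (nat m) else 0)))\<^sup>2 \<le> 0"
      by (rule field_le_epsilon)
    then show ?thesis by simp
  qed
  ultimately show ?thesis by blast
qed

section \<open>Dyadic blocks and the multiplier theorem\<close>

lemma sum_dyadic_blocks:
  fixes w :: "nat \<Rightarrow> 'a::comm_monoid_add"
  shows "(\<Sum>n<2 ^ J. w n) = w 0 + (\<Sum>j<J. \<Sum>n\<in>{2 ^ j..<2 ^ (j + 1)}. w n)"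
proof (induction J)
  case (Suc J)
  have "(\<Sum>n<2 ^ Suc J. w n) = (\<Sum>n<2 ^ J. w n) + (\<Sum>n\<in>{2 ^ J..<2 ^ (J + 1)}. w n)"
    unfolding lessThan_atLeast0 by (subst sum.atLeastLessThan_concat) auto
  then show ?case using Suc by (simp add: add.assoc)
qed simp

lemma sum_even_odd:
  fixes w :: "nat \<Rightarrow> 'a::comm_monoid_add"
  shows "(\<Sum>j<2 * J. w j) = (\<Sum>i<J. w (2 * i)) + (\<Sum>i<J. w (2 * i + 1))"
  by (induction J) (auto simp: algebra_simps)

text \<open>Indices from neighbouring blocks may be too close, but two blocks apart 2
  \<open>\<nu> j\<close> < 2^(j+2), which is at most \<open>\<nu> (j + 2)\<close>. Even and odd
  blocks thus each form a lacunary sequence, whence the factor 2.\<close>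

lemma dyadic_paley:
  assumes f: "f \<in> H1" and \<nu>: "\<And>j. \<nu> j \<in> {2 ^ j..<2 ^ (j + 1)}"
  shows "(\<Sum>j<J. (cmod (fourier_coeff f (int (\<nu> j))))\<^sup>2) \<le> 2 * (LINT t|circle_measure. cmod (f t))\<^sup>2"
proof -
  define w where "w j = (cmod (fourier_coeff f (int (\<nu> j))))\<^sup>2" for j
  have lac: "2 * \<nu> j < \<nu> k" if "j + 2 \<le> k" for j k
  proof -
    have "2 * \<nu> j < 2 ^ (j + 2)" using \<nu> [of j] by simp
    also have "\<dots> \<le> 2 ^ k" using that by (intro power_increasing) auto
    also have "\<dots> \<le> \<nu> k" using \<nu> [of k] by simp
    finally show ?thesis .
  qed
  have "(\<Sum>j<J. w j) \<le> (\<Sum>j<2 * J. w j)" by (rule sum_mono2) (auto simp: w_def)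
  also have "\<dots> = (\<Sum>i<J. w (2 * i)) + (\<Sum>i<J. w (2 * i + 1))" by (rule sum_even_odd)
  also have "(\<Sum>i<J. w (2 * i)) \<le> (LINT t|circle_measure. cmod (f t))\<^sup>2"
    unfolding w_def by (rule lacunary_paley [OF f]) (simp add: lac)
  also have "(\<Sum>i<J. w (2 * i + 1)) \<le> (LINT t|circle_measure. cmod (f t))\<^sup>2"
    unfolding w_def by (rule lacunary_paley [OF f]) (simp add: lac)
  finally show ?thesis by (simp add: w_def)
qed

text \<open>In each block all coefficients of \<open>f\<close> are replaced by the largest one, so
  that the block sum of |a|^2, at most \<open>K\<close>, factors out. The block maxima are
  controlled by \<open>dyadic_paley\<close>.\<close>

lemma summable_multiplier:
  fixes a :: "nat \<Rightarrow> complex"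
  assumes f: "f \<in> H1" and K: "\<And>j. (\<Sum>n\<in>{2 ^ j..<2 ^ (j + 1)}. (cmod (a n))\<^sup>2) \<le> K"
  shows "summable (\<lambda>n. (cmod (a n * fourier_coeff f (int n)))\<^sup>2)"
proof (rule summableI_nonneg_bounded)
  define w where "w n = (cmod (a n * fourier_coeff f (int n)))\<^sup>2" for n
  define \<phi> where "\<phi> n = (cmod (fourier_coeff f (int n)))\<^sup>2" for n
  have K0: "0 \<le> K" by (rule order_trans [OF _ K [of 0]]) (rule sum_nonneg, simp)
  have "\<exists>m\<in>{2 ^ j..<2 ^ (j + 1)}. \<forall>n\<in>{2 ^ j..<2 ^ (j + 1)}. \<phi> n \<le> \<phi> m" for j :: nat
  proof -
    have "Max (\<phi> ` {2 ^ j..<2 ^ (j + 1)}) \<in> \<phi> ` {2 ^ j..<2 ^ (j + 1)}" by (rule Max_in) auto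
    then obtain m where "m \<in> {2 ^ j..<2 ^ (j + 1)}" "\<phi> m = Max (\<phi> ` {2 ^ j..<2 ^ (j + 1)})"
      by (metis imageE)
    moreover from this have "\<phi> n \<le> \<phi> m" if "n \<in> {2 ^ j..<2 ^ (j + 1)}" for n
      using that by (simp only: Max_ge finite_imageI finite_atLeastLessThan imageI)
    ultimately show ?thesis by blast
  qed
  then obtain \<nu> where \<nu>: "\<And>j::nat. \<nu> j \<in> {2 ^ j..<2 ^ (j + 1)}"
    "\<And>j n. n \<in> {2 ^ j..<2 ^ (j + 1)} \<Longrightarrow> \<phi> n \<le> \<phi> (\<nu> j)"
    by metis
  \<comment> \<open>Index 0 lies in no dyadic block and contributes the separate term
    \<open>w 0\<close>.\<close>
  show "(\<Sum>n<J. w n) \<le> w 0 + K * (2 * (LINT t|circle_measure. cmod (f t))\<^sup>2)" for J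
  proof -
    have "(\<Sum>n<J. w n) \<le> (\<Sum>n<2 ^ J. w n)"
      using less_exp [of J] by (intro sum_mono2) (auto simp: w_def)
    also have "\<dots> = w 0 + (\<Sum>j<J. \<Sum>n\<in>{2 ^ j..<2 ^ (j + 1)}. w n)" by (rule sum_dyadic_blocks)
    also have "(\<Sum>j<J. \<Sum>n\<in>{2 ^ j..<2 ^ (j + 1)}. w n) \<le> (\<Sum>j<J. K * \<phi> (\<nu> j))"
    proof (rule sum_mono)
      fix j
      have "(\<Sum>n\<in>{2 ^ j..<2 ^ (j + 1)}. w n) \<le> (\<Sum>n\<in>{2 ^ j..<2 ^ (j + 1)}. (cmod (a n))\<^sup>2 * \<phi> (\<nu> j))"
      proof (rule sum_mono)
        fix n :: nat assume "n \<in> {2 ^ j..<2 ^ (j + 1)}"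
        then have "(cmod (a n))\<^sup>2 * \<phi> n \<le> (cmod (a n))\<^sup>2 * \<phi> (\<nu> j)"
          by (intro mult_left_mono \<nu>(2)) auto
        then show "w n \<le> (cmod (a n))\<^sup>2 * \<phi> (\<nu> j)"
          by (simp add: w_def \<phi>_def norm_mult power_mult_distrib)
      qed
      also have "\<dots> \<le> K * \<phi> (\<nu> j)"
        unfolding sum_distrib_right [symmetric] by (intro mult_right_mono K) (simp add: \<phi>_def)
      finally show "(\<Sum>n\<in>{2 ^ j..<2 ^ (j + 1)}. w n) \<le> K * \<phi> (\<nu> j)" .
    qed
    also have "\<dots> \<le> K * (2 * (LINT t|circle_measure. cmod (f t))\<^sup>2)"
      unfolding sum_distrib_left [symmetric] \<phi>_def
      by (intro mult_left_mono dyadic_paley f \<nu>(1) K0)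
    finally show ?thesis by simp
  qed
  show "0 \<le> w n" for n by (simp add: w_def)
qed

theorem theorem1p3:
  fixes a :: "nat \<Rightarrow> complex"
  assumes "(SUP j::nat. ereal (\<Sum>n\<in>{2 ^ j..<2 ^ (j + 1)}. (cmod (a n))\<^sup>2)) < \<infinity>"
  shows "paley_multiplier a"
proof -
  define x where "x j = (\<Sum>n\<in>{2 ^ j..<2 ^ (j + 1)}. (cmod (a n))\<^sup>2)" for j :: nat
  have "(SUP j. ereal (x j)) \<noteq> \<infinity>" using assms by (simp add: x_def)
  moreover have upper: "ereal (x j) \<le> (SUP j. ereal (x j))" for j
    by (rule SUP_upper) simp
  \<comment> \<open>The term at 0 is a finite lower bound for the supremum, which excludes minus
    infinity.\<close>
  ultimately obtain K where "(SUP j. ereal (x j)) = ereal K"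
    using upper [of 0] by (cases "SUP j. ereal (x j)") auto
  then have "x j \<le> K" for j using upper [of j] by simp
  then have K: "(\<Sum>n\<in>{2 ^ j..<2 ^ (j + 1)}. (cmod (a n))\<^sup>2) \<le> K" for j :: nat
    by (simp add: x_def)
  show ?thesis
    unfolding paley_multiplier_def
  proof
    fix f assume "f \<in> H1"
    then have "summable (\<lambda>n. (cmod (a n * fourier_coeff f (int n)))\<^sup>2)"
      using K by (rule summable_multiplier)
    from riesz_fischer [OF this] obtain g where g: "g \<in> L2"
      "\<And>m. fourier_coeff g m = (if 0 \<le> m then a (nat m) * fourier_coeff f (int (nat m)) else 0)"
      by blast
    then have "g \<in> H2" by (simp add: H2_def)
    with g(2) show "\<exists>g\<in>H2. \<forall>n. fourier_coeff g (int n) = a n * fourier_coeff f (int n)"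
      by (intro bexI [of _ g]) simp_all
  qed
qed

end
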